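(* Let $n\ge 3$ be an integer and let $G$ be a connected balanced bipartite graph on $2n$ vertices (i.e., both parts have $n$ vertices). If $\lambda_1(D(G))\le \lambda_1(D(B_{n-1,n-2}))$, then $G$ has a perfect matching unless $G\cong B_{n-1,n-2}$, where $B_{n-1,n-2}$ is the graph obtained from the complete bipartite graph $K_{n,n-2}$ by attaching two pendent vertices to one vertex of the part of size $n$.
   Context: All graphs are finite, simple, undirected and connected. For a connected graph $H$ with vertices $v_1,\dots,v_m$, the distance matrix $D(H)$ is the $m\times m$ matrix whose $(i,j)$-entry is the length of a shortest path between $v_i$ and $v_j$; its largest eigenvalue $\lambda_1(D(H))$ is the distance spectral radius. A perfect matching is a set of pairwise nonadjacent edges covering every vertex. A pendent vertex is a vertex of degree $1$; attaching a pendent vertex to $v$ means adding a new vertex adjacent only to $v$. *)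

theory Defs
  imports Complex_Main
begin

definition simple_graph :: "'a set \<Rightarrow> ('a \<Rightarrow> 'a \<Rightarrow> bool) \<Rightarrow> bool" where
  "simple_graph V E \<longleftrightarrow> finite V \<and> (\<forall>u v. E u v \<longrightarrow> u \<in> V \<and> v \<in> V)
     \<and> (\<forall>u v. E u v \<longrightarrow> E v u) \<and> (\<forall>u. \<not> E u u)"

definition walk :: "'a set \<Rightarrow> ('a \<Rightarrow> 'a \<Rightarrow> bool) \<Rightarrow> 'a list \<Rightarrow> bool" where
  "walk V E xs \<longleftrightarrow> xs \<noteq> [] \<and> set xs \<subseteq> V \<and> (\<forall>i. Suc i < length xs \<longrightarrow> E (xs ! i) (xs ! Suc i))"

definition connected_graph :: "'a set \<Rightarrow> ('a \<Rightarrow> 'a \<Rightarrow> bool) \<Rightarrow> bool" where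
  "connected_graph V E \<longleftrightarrow> V \<noteq> {} \<and>
     (\<forall>u\<in>V. \<forall>v\<in>V. \<exists>xs. walk V E xs \<and> hd xs = u \<and> last xs = v)"

definition gdist :: "'a set \<Rightarrow> ('a \<Rightarrow> 'a \<Rightarrow> bool) \<Rightarrow> 'a \<Rightarrow> 'a \<Rightarrow> nat" where
  "gdist V E u v = (LEAST k. \<exists>xs. walk V E xs \<and> hd xs = u \<and> last xs = v \<and> length xs = Suc k)"

definition dist_eigenvalue :: "'a set \<Rightarrow> ('a \<Rightarrow> 'a \<Rightarrow> bool) \<Rightarrow> real \<Rightarrow> bool" where
  "dist_eigenvalue V E \<mu> \<longleftrightarrow> (\<exists>x :: 'a \<Rightarrow> real. (\<exists>v\<in>V. x v \<noteq> 0) \<and>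
     (\<forall>u\<in>V. (\<Sum>w\<in>V. real (gdist V E u w) * x w) = \<mu> * x u))"

definition dist_spectral_radius :: "'a set \<Rightarrow> ('a \<Rightarrow> 'a \<Rightarrow> bool) \<Rightarrow> real" where
  "dist_spectral_radius V E = Max {\<mu>. dist_eigenvalue V E \<mu>}"

definition balanced_bipartite :: "'a set \<Rightarrow> ('a \<Rightarrow> 'a \<Rightarrow> bool) \<Rightarrow> nat \<Rightarrow> bool" where
  "balanced_bipartite V E n \<longleftrightarrow> (\<exists>A B. V = A \<union> B \<and> A \<inter> B = {} \<and> card A = n \<and> card B = n
     \<and> (\<forall>u v. E u v \<longrightarrow> (u \<in> A \<and> v \<in> B) \<or> (u \<in> B \<and> v \<in> A)))"

definition perfect_matching :: "'a set \<Rightarrow> ('a \<Rightarrow> 'a \<Rightarrow> bool) \<Rightarrow> 'a set set \<Rightarrow> bool" where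
  "perfect_matching V E M \<longleftrightarrow> (\<forall>e\<in>M. \<exists>u v. e = {u, v} \<and> E u v)
     \<and> (\<forall>v\<in>V. \<exists>!e. e \<in> M \<and> v \<in> e)"

definition has_perfect_matching :: "'a set \<Rightarrow> ('a \<Rightarrow> 'a \<Rightarrow> bool) \<Rightarrow> bool" where
  "has_perfect_matching V E \<longleftrightarrow> (\<exists>M. perfect_matching V E M)"

definition graph_iso :: "'a set \<Rightarrow> ('a \<Rightarrow> 'a \<Rightarrow> bool) \<Rightarrow> 'b set \<Rightarrow> ('b \<Rightarrow> 'b \<Rightarrow> bool) \<Rightarrow> bool" where
  "graph_iso V E V' E' \<longleftrightarrow> (\<exists>f. bij_betw f V V' \<and> (\<forall>u\<in>V. \<forall>v\<in>V. E u v \<longleftrightarrow> E' (f u) (f v)))"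

text \<open>B_{n-1,n-2}: K_{n,n-2} with parts X = {0..<n}, Y = {n..<2n-2}, plus pendent
  vertices 2n-2 and 2n-1 attached to vertex 0 of X.\<close>
definition B_verts :: "nat \<Rightarrow> nat set" where
  "B_verts n = {0..<2*n}"

definition B_adj :: "nat \<Rightarrow> nat \<Rightarrow> nat \<Rightarrow> bool" where
  "B_adj n u v \<longleftrightarrow>
     (u < n \<and> n \<le> v \<and> v < 2*n - 2) \<or> (v < n \<and> n \<le> u \<and> u < 2*n - 2)
     \<or> (u = 0 \<and> (v = 2*n - 2 \<or> v = 2*n - 1)) \<or> (v = 0 \<and> (u = 2*n - 2 \<or> u = 2*n - 1))"

end

theory Submission
  imports Defs "HOL-Analysis.Analysis"
begin

text \<open>
  Let \<open>A\<close> and \<open>B\<close> be the parts of \<open>G\<close>. If \<open>G\<close> has no perfect matching, Hall's theorem yields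
  \<open>S \<subseteq> A\<close> and \<open>T \<subseteq> B\<close> with no edges between them and \<open>|S| + |T| = n + 1\<close>; connectedness
  forces \<open>|S|, |T| \<ge> 2\<close>. Hence the distance matrix of \<open>G\<close> dominates entrywise that of the
  complete bipartite graph with the edges between \<open>S\<close> and \<open>T\<close> removed. The latter has a positive
  eigenvector, constant on \<open>S\<close>, \<open>A - S\<close>, \<open>T\<close> and \<open>B - T\<close>, for the eigenvalue \<open>\<mu> - 2\<close>, where
  \<open>\<mu> > 3n\<close> is a root of a quartic depending only on \<open>n\<close> and on the product \<open>p = |S| |T|\<close>. On
  \<open>\<mu> > 3n\<close> the quartic decreases in \<open>p\<close>, so the spectral radius increases with \<open>p\<close>. The product
  is least when \<open>{|S|, |T|} = {2, n - 1}\<close>, which is the graph \<open>B_{n-1,n-2}\<close>. Testing the Rayleigh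
  quotient of \<open>G\<close> with the positive eigenvector shows that its spectral radius exceeds that of
  \<open>B_{n-1,n-2}\<close> unless \<open>p\<close> is least and all distances agree.
\<close>

subsection \<open>Hall's marriage theorem\<close>

text \<open>Halmos-Vaughan induction on \<open>card A\<close>. If some nonempty proper subset
  \<open>S\<close> is tight, \<open>S\<close> is matched into its neighbourhood and the rest outside
  it. If none is tight, every nonempty proper subset has a neighbour to spare, so any pair
  \<open>a\<close>, \<open>b\<close> with \<open>b \<in> N a\<close> can be fixed first.\<close>

lemma hall_marriage:
  fixes N :: "'a \<Rightarrow> 'b set"
  assumes "finite A" and "\<And>a. a \<in> A \<Longrightarrow> finite (N a)"
    and "\<And>S. S \<subseteq> A \<Longrightarrow> card S \<le> card (\<Union>(N ` S))"
  shows "\<exists>f. inj_on f A \<and> (\<forall>a\<in>A. f a \<in> N a)"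
  using assms
proof (induction "card A" arbitrary: A N rule: less_induct)
  case less
  show ?case
  proof (cases "A = {}")
    case True
    then show ?thesis by simp
  next
    case False
    show ?thesis
    proof (cases "\<exists>S. S \<subset> A \<and> S \<noteq> {} \<and> card S = card (\<Union>(N ` S))")
      case True
      then obtain S where S: "S \<subset> A" "S \<noteq> {}" "card S = card (\<Union>(N ` S))" by blast
      define U where "U = \<Union>(N ` S)"
      have finS: "finite S" using S less.prems(1) by (meson finite_subset psubset_imp_subset)
      have finU: "finite U" unfolding U_def using finS S less.prems(2) by blast
      have "\<exists>f. inj_on f S \<and> (\<forall>a\<in>S. f a \<in> N a)"
      proof (intro less.hyps)
        show "card S < card A" using S(1) less.prems(1) by (simp add: psubset_card_mono)
      qed (use S finS less.prems in auto)
      then obtain f where f: "inj_on f S" "\<And>a. a \<in> S \<Longrightarrow> f a \<in> N a" by blast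
      have "\<exists>g. inj_on g (A - S) \<and> (\<forall>a\<in>A - S. g a \<in> N a - U)"
      proof (intro less.hyps)
        show "card (A - S) < card A"
          using S less.prems(1) by (intro psubset_card_mono) auto
        fix R assume R: "R \<subseteq> A - S"
        have finR: "finite R" using R less.prems(1) by (meson finite_Diff finite_subset)
        \<comment> \<open>Hall's condition for \<open>R \<union> S\<close>, minus the equality for
          the tight set \<open>S\<close>, leaves Hall's condition for \<open>R\<close> outside
          \<open>U\<close>.\<close>
        have "card R + card S = card (R \<union> S)"
          using R finR finS by (subst card_Un_disjoint) auto
        also have "\<dots> \<le> card (\<Union>(N ` (R \<union> S)))" using R S by (intro less.prems) auto
        also have "\<Union>(N ` (R \<union> S)) = (\<Union>a\<in>R. N a - U) \<union> U" by (auto simp: U_def)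
        also have "card \<dots> \<le> card (\<Union>a\<in>R. N a - U) + card U" by (rule card_Un_le)
        finally show "card R \<le> card (\<Union>a\<in>R. N a - U)" using S by (simp add: U_def)
      qed (use less.prems in auto)
      then obtain g where g: "inj_on g (A - S)" "\<And>a. a \<in> A - S \<Longrightarrow> g a \<in> N a - U" by blast
      have fU: "f a \<in> U" if "a \<in> S" for a using f(2)[OF that] that by (auto simp: U_def)
      define h where "h a = (if a \<in> S then f a else g a)" for a
      have "inj_on h A"
      proof (rule inj_onI)
        fix x y assume xy: "x \<in> A" "y \<in> A" "h x = h y"
        show "x = y"
        proof (cases "x \<in> S"; cases "y \<in> S")
        qed (use xy fU g(2) inj_onD[OF f(1)] inj_onD[OF g(1)] in \<open>force simp: h_def\<close>)+
      qed
      moreover have "\<forall>a\<in>A. h a \<in> N a" using f(2) g(2) by (auto simp: h_def)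
      ultimately show ?thesis by blast
    next
      case False
      obtain a where a: "a \<in> A" using \<open>A \<noteq> {}\<close> by blast
      have "1 \<le> card (N a)" using less.prems(3)[of "{a}"] a by simp
      then obtain b where b: "b \<in> N a" by fastforce
      have "\<exists>g. inj_on g (A - {a}) \<and> (\<forall>x\<in>A - {a}. g x \<in> N x - {b})"
      proof (intro less.hyps)
        show "card (A - {a}) < card A"
          using a less.prems(1) by (intro psubset_card_mono) auto
        fix R assume R: "R \<subseteq> A - {a}"
        show "card R \<le> card (\<Union>x\<in>R. N x - {b})"
        proof (cases "R = {}")
          case False
          have "R \<subset> A" using R a by blast
          with \<open>\<nexists>S. _ S\<close> False have "card R \<noteq> card (\<Union>(N ` R))" by blast
          moreover have "card R \<le> card (\<Union>(N ` R))" using R by (intro less.prems) auto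
          moreover have "(\<Union>x\<in>R. N x - {b}) = \<Union>(N ` R) - {b}" by auto
          moreover have "card (\<Union>(N ` R)) - 1 \<le> card (\<Union>(N ` R) - {b})"
            by (simp add: card_Diff_singleton_if)
          ultimately show ?thesis by simp
        qed simp
      qed (use less.prems in auto)
      then obtain g where g: "inj_on g (A - {a})" "\<And>x. x \<in> A - {a} \<Longrightarrow> g x \<in> N x - {b}" by blast
      have "inj_on (g(a := b)) A"
      proof (rule inj_onI)
        fix x y assume "x \<in> A" "y \<in> A" "(g(a := b)) x = (g(a := b)) y"
        then show "x = y" using g(2) inj_onD[OF g(1), of x y] by (auto split: if_splits)
      qed
      moreover have "\<forall>x\<in>A. (g(a := b)) x \<in> N x" using g(2) b by auto
      ultimately show ?thesis by blast
    qed
  qed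
qed

subsection \<open>Eigenvalues of symmetric matrices indexed by a finite set\<close>

text \<open>First-order optimality: for small \<open>t\<close> of the sign of \<open>e\<close> the
  linear term would outgrow the quadratic one. It is applied to the Rayleigh quotient at its
  maximiser.\<close>

lemma linear_dominated_by_square_imp_zero:
  fixes e k :: real
  assumes "\<And>t. 2 * t * e \<le> t\<^sup>2 * k"
  shows "e = 0"
proof (rule ccontr)
  assume "e \<noteq> 0"
  \<comment> \<open>\<open>K\<close> is positive and exceeds \<open>k\<close>, so the choice
    \<open>t = e / K\<close> yields \<open>2 * e\<^sup>2 \<le> e\<^sup>2\<close>.\<close>
  define K where "K = \<bar>k\<bar> + 1"
  have K: "K > 0" "k < K" by (auto simp: K_def)
  have "2 * (e / K) * e \<le> (e / K)\<^sup>2 * k" by (rule assms)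
  also have "\<dots> \<le> (e / K)\<^sup>2 * K" using K by (intro mult_left_mono) auto
  also have "\<dots> = e\<^sup>2 / K" using K by (simp add: power2_eq_square)
  finally have "2 * e\<^sup>2 \<le> e\<^sup>2" using K by (simp add: field_simps power2_eq_square)
  with \<open>e \<noteq> 0\<close> show False by simp
qed

definition eigenpair_on :: "'a set \<Rightarrow> ('a \<Rightarrow> 'a \<Rightarrow> real) \<Rightarrow> real \<Rightarrow> ('a \<Rightarrow> real) \<Rightarrow> bool" where
  "eigenpair_on V D \<mu> x \<longleftrightarrow> (\<exists>v\<in>V. x v \<noteq> 0) \<and> (\<forall>u\<in>V. (\<Sum>w\<in>V. D u w * x w) = \<mu> * x u)"

text \<open>Rayleigh's principle: a maximiser of the quadratic form on the unit sphere is an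
  eigenvector, because changing one coordinate cannot raise the Rayleigh quotient.\<close>

lemma symmetric_max_eigenpair:
  fixes D :: "'a \<Rightarrow> 'a \<Rightarrow> real"
  assumes fin: "finite V" and ne: "V \<noteq> {}"
    and sym: "\<And>u v. u \<in> V \<Longrightarrow> v \<in> V \<Longrightarrow> D u v = D v u"
  shows "\<exists>\<mu> x. eigenpair_on V D \<mu> x \<and>
    (\<forall>y. (\<Sum>u\<in>V. \<Sum>w\<in>V. D u w * y u * y w) \<le> \<mu> * (\<Sum>u\<in>V. (y u)\<^sup>2))"
proof -
  define Q where "Q y = (\<Sum>u\<in>V. \<Sum>w\<in>V. D u w * y u * y w)" for y :: "'a \<Rightarrow> real"
  define R where "R y = (\<Sum>u\<in>V. (y u)\<^sup>2)" for y :: "'a \<Rightarrow> real"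
  \<comment> \<open>Vectors are functions on the whole type, so they are pinned to 0 outside
    \<open>V\<close>. The unit sphere then lies in a product of compact sets, and compactness comes
    from the product topology.\<close>
  define K where "K = PiE UNIV (\<lambda>i. if i \<in> V then {-1..1::real} else {0}) \<inter> {x. R x = 1}"
  have contR: "continuous_on UNIV R" unfolding R_def by (intro continuous_intros continuous_on_product_coordinates)
  have contQ: "continuous_on K Q" unfolding Q_def
    by (rule continuous_on_subset[of UNIV], intro continuous_intros continuous_on_product_coordinates) auto
  have "compactin (product_topology (\<lambda>i. euclidean) UNIV) (PiE UNIV (\<lambda>i::'a. if i \<in> V then {-1..1::real} else {0}))"
    by (subst compactin_PiE) (auto simp: compactin_euclidean_iff)
  hence "compact (PiE UNIV (\<lambda>i::'a. if i \<in> V then {-1..1::real} else {0}))"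
    by (simp add: euclidean_product_topology compactin_euclidean_iff)
  moreover have "closed {x. R x = 1}"
    by (rule closed_Collect_eq[OF contR continuous_on_const])
  ultimately have "compact K" unfolding K_def by (rule compact_Int_closed)
  have normalise: "\<exists>z\<in>K. \<forall>v\<in>V. y v = sqrt (R y) * z v" if "R y \<noteq> 0" for y
  proof -
    have pos: "R y > 0" using that by (simp add: R_def sum_nonneg order_less_le)
    define z where "z v = (if v \<in> V then y v / sqrt (R y) else 0)" for v
    have "R z = (\<Sum>u\<in>V. (y u)\<^sup>2 / R y)" unfolding R_def[of z]
      using pos by (intro sum.cong) (auto simp: z_def power_divide)
    also have "\<dots> = 1" using that by (simp add: sum_divide_distrib[symmetric] R_def)
    finally have Rz: "R z = 1" .
    have "\<bar>z v\<bar> \<le> 1" if "v \<in> V" for v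
    proof -
      have "(z v)\<^sup>2 \<le> R z" unfolding R_def using that fin by (intro member_le_sum) auto
      thus ?thesis using Rz by (simp add: abs_square_le_1)
    qed
    hence "z \<in> PiE UNIV (\<lambda>i. if i \<in> V then {-1..1::real} else {0})"
      by (auto simp: abs_le_iff minus_le_iff) (simp add: z_def)
    hence "z \<in> K" using Rz by (simp add: K_def)
    moreover have "\<forall>v\<in>V. y v = sqrt (R y) * z v" using pos by (simp add: z_def)
    ultimately show ?thesis by blast
  qed
  have "R (\<lambda>_. 1) \<noteq> 0" using fin ne by (simp add: R_def)
  from normalise[OF this] have "K \<noteq> {}" by blast
  with \<open>compact K\<close> contQ obtain x where x: "x \<in> K" "\<And>y. y \<in> K \<Longrightarrow> Q y \<le> Q x"
    by (meson continuous_attains_sup)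
  define \<mu> where "\<mu> = Q x"
  have Rx: "R x = 1" using x by (simp add: K_def)
  have bound: "Q y \<le> \<mu> * R y" for y
  proof (cases "R y = 0")
    case True
    hence "\<forall>v\<in>V. y v = 0" using fin by (simp add: R_def sum_nonneg_eq_0_iff)
    thus ?thesis using True by (simp add: Q_def)
  next
    case False
    then obtain z where z: "z \<in> K" "\<And>v. v \<in> V \<Longrightarrow> y v = sqrt (R y) * z v" using normalise by blast
    have nn: "R y \<ge> 0" by (simp add: R_def sum_nonneg)
    have "Q y = (\<Sum>u\<in>V. \<Sum>w\<in>V. R y * (D u w * z u * z w))" unfolding Q_def
    proof (intro sum.cong refl)
      fix u w assume "u \<in> V" "w \<in> V"
      then have "D u w * y u * y w = D u w * (sqrt (R y) * z u) * (sqrt (R y) * z w)" using z(2) by metis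
      also have "\<dots> = (sqrt (R y) * sqrt (R y)) * (D u w * z u * z w)" by (simp add: mult_ac)
      finally show "D u w * y u * y w = R y * (D u w * z u * z w)" using nn by simp
    qed
    also have "\<dots> = R y * Q z" by (simp add: Q_def sum_distrib_left)
    also have "\<dots> \<le> R y * \<mu>" using x(2)[OF z(1)] nn by (simp add: \<mu>_def mult_left_mono)
    finally show ?thesis by (simp add: mult.commute)
  qed
  have "(\<Sum>w\<in>V. D v w * x w) = \<mu> * x v" if v: "v \<in> V" for v
  proof -
    define c where "c = (\<Sum>w\<in>V. D v w * x w)"
    \<comment> \<open>Moving \<open>x\<close> by \<open>t\<close> in coordinate \<open>v\<close> and
      inserting the result into \<open>bound\<close>, the constant terms cancel since
      \<open>Q x = \<mu>\<close> and \<open>R x = 1\<close>; this is what remains.\<close>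
    have "2 * t * (c - \<mu> * x v) \<le> t\<^sup>2 * (\<mu> - D v v)" for t
    proof -
      define e where "e u = (if u = v then t else 0)" for u
      have Qe: "Q (\<lambda>u. x u + e u) = Q x + 2 * t * c + t\<^sup>2 * D v v"
      proof -
        have ex: "(\<Sum>u\<in>V. \<Sum>w\<in>V. D u w * e u * x w) = t * c"
        proof -
          have "(\<Sum>u\<in>V. \<Sum>w\<in>V. D u w * e u * x w) = (\<Sum>u\<in>V. if u = v then t * c else 0)"
            by (intro sum.cong) (auto simp: e_def c_def sum_distrib_left mult_ac)
          thus ?thesis using fin v by simp
        qed
        have "Q (\<lambda>u. x u + e u) = Q x + (\<Sum>u\<in>V. \<Sum>w\<in>V. D u w * x u * e w)
            + (\<Sum>u\<in>V. \<Sum>w\<in>V. D u w * e u * x w) + (\<Sum>u\<in>V. \<Sum>w\<in>V. D u w * e u * e w)"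
          by (simp add: Q_def algebra_simps sum.distrib)
        also note ex
        also have "(\<Sum>u\<in>V. \<Sum>w\<in>V. D u w * x u * e w) = (\<Sum>u\<in>V. \<Sum>w\<in>V. D u w * e u * x w)"
          by (subst sum.swap) (intro sum.cong refl, simp add: sym mult_ac)
        also note ex
        also have "(\<Sum>u\<in>V. \<Sum>w\<in>V. D u w * e u * e w) = t\<^sup>2 * D v v"
        proof -
          have "(\<Sum>u\<in>V. \<Sum>w\<in>V. D u w * e u * e w)
              = (\<Sum>u\<in>V. \<Sum>w\<in>V. if w = v then (if u = v then t\<^sup>2 * D v v else 0) else 0)"
            by (intro sum.cong refl) (simp add: e_def power2_eq_square mult_ac)
          thus ?thesis using fin v by simp
        qed
        finally show ?thesis by simp
      qed
      have "R (\<lambda>u. x u + e u) = R x + (\<Sum>u\<in>V. if u = v then 2 * t * x v + t\<^sup>2 else 0)"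
        unfolding R_def sum.distrib[symmetric]
        by (intro sum.cong) (auto simp: e_def power2_eq_square algebra_simps)
      hence "R (\<lambda>u. x u + e u) = 1 + 2 * t * x v + t\<^sup>2" using fin v Rx by simp
      with bound[of "\<lambda>u. x u + e u"] Qe show ?thesis by (simp add: \<mu>_def algebra_simps)
    qed
    from linear_dominated_by_square_imp_zero[OF this] show ?thesis by (simp add: c_def)
  qed
  moreover have "\<exists>v\<in>V. x v \<noteq> 0"
  proof (rule ccontr)
    assume "\<not> ?thesis"
    hence "R x = 0" by (simp add: R_def)
    with Rx show False by simp
  qed
  ultimately show ?thesis using bound unfolding Q_def R_def eigenpair_on_def by blast
qed

text \<open>Normalised eigenvectors for distinct eigenvalues are orthonormal, so Bessel's inequality
  for the standard basis vectors bounds their number by the dimension.\<close>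

lemma finite_eigenvalues_symmetric:
  fixes D :: "'a \<Rightarrow> 'a \<Rightarrow> real"
  assumes fin: "finite V" and sym: "\<And>u v. u \<in> V \<Longrightarrow> v \<in> V \<Longrightarrow> D u v = D v u"
  shows "finite {\<mu>. \<exists>x. eigenpair_on V D \<mu> x}"
proof -
  define L where "L = {\<mu>. \<exists>x. eigenpair_on V D \<mu> x}"
  have "\<exists>z. (\<Sum>u\<in>V. (z u)\<^sup>2) = 1 \<and> (\<forall>u\<in>V. (\<Sum>w\<in>V. D u w * z w) = \<mu> * z u)" if "\<mu> \<in> L" for \<mu>
  proof -
    from that obtain x v where x: "v \<in> V" "x v \<noteq> 0" "\<forall>u\<in>V. (\<Sum>w\<in>V. D u w * x w) = \<mu> * x u"
      by (auto simp: L_def eigenpair_on_def)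
    define r where "r = (\<Sum>u\<in>V. (x u)\<^sup>2)"
    have "(x v)\<^sup>2 \<le> r" unfolding r_def using x fin by (intro member_le_sum) auto
    hence r: "r > 0" using x(2) by (smt (verit) zero_less_power2)
    have "(\<Sum>u\<in>V. (x u / sqrt r)\<^sup>2) = (\<Sum>u\<in>V. (x u)\<^sup>2) / r"
      using r by (simp add: power_divide sum_divide_distrib)
    moreover have "(\<Sum>w\<in>V. D u w * (x w / sqrt r)) = \<mu> * (x u / sqrt r)" if "u \<in> V" for u
      using x(3) that by (simp add: sum_divide_distrib[symmetric])
    ultimately show ?thesis using r by (intro exI[of _ "\<lambda>u. x u / sqrt r"]) (auto simp: r_def)
  qed
  then obtain z where z1: "\<And>\<mu>. \<mu> \<in> L \<Longrightarrow> (\<Sum>u\<in>V. (z \<mu> u)\<^sup>2) = 1"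
    and z2: "\<And>\<mu> u. \<mu> \<in> L \<Longrightarrow> u \<in> V \<Longrightarrow> (\<Sum>w\<in>V. D u w * z \<mu> w) = \<mu> * z \<mu> u" by metis
  have orth: "(\<Sum>u\<in>V. z \<mu> u * z \<nu> u) = (if \<mu> = \<nu> then 1 else 0)" if "\<mu> \<in> L" "\<nu> \<in> L" for \<mu> \<nu>
  proof (cases "\<mu> = \<nu>")
    case True
    then show ?thesis using z1 that by (simp add: power2_eq_square)
  next
    case False
    have "\<mu> * (\<Sum>u\<in>V. z \<mu> u * z \<nu> u) = (\<Sum>u\<in>V. \<Sum>w\<in>V. D u w * z \<mu> w * z \<nu> u)"
      by (simp add: sum_distrib_left mult.assoc[symmetric] z2[OF that(1), symmetric] sum_distrib_right)
    also have "\<dots> = (\<Sum>w\<in>V. \<Sum>u\<in>V. D w u * z \<nu> u * z \<mu> w)"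
      by (subst sum.swap) (intro sum.cong refl, simp add: sym mult_ac)
    also have "\<dots> = \<nu> * (\<Sum>u\<in>V. z \<nu> u * z \<mu> u)"
      by (simp add: sum_distrib_left mult.assoc[symmetric] z2[OF that(2), symmetric] sum_distrib_right)
    also have "\<dots> = \<nu> * (\<Sum>u\<in>V. z \<mu> u * z \<nu> u)" by (simp add: mult.commute)
    finally show ?thesis using False by simp
  qed
  have "card F \<le> card V" if F: "F \<subseteq> L" "finite F" for F
  proof -
    have bessel: "(\<Sum>\<mu>\<in>F. (z \<mu> v)\<^sup>2) \<le> 1" if v: "v \<in> V" for v
    proof -
      \<comment> \<open>\<open>p\<close> is the orthogonal projection of the basis vector at
        \<open>v\<close> onto the span of the chosen eigenvectors; hence its squared norm equals its
        own entry \<open>p v\<close>.\<close>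
      define p where "p u = (\<Sum>\<mu>\<in>F. z \<mu> v * z \<mu> u)" for u
      have pp: "(\<Sum>u\<in>V. (p u)\<^sup>2) = p v"
      proof -
        have "(\<Sum>u\<in>V. (p u)\<^sup>2) = (\<Sum>u\<in>V. \<Sum>\<mu>\<in>F. \<Sum>\<nu>\<in>F. z \<mu> v * z \<nu> v * (z \<mu> u * z \<nu> u))"
          by (simp add: p_def power2_eq_square sum_product mult_ac)
        also have "\<dots> = (\<Sum>\<mu>\<in>F. \<Sum>\<nu>\<in>F. \<Sum>u\<in>V. z \<mu> v * z \<nu> v * (z \<mu> u * z \<nu> u))"
          by (subst sum.swap, rule sum.cong[OF refl], rule sum.swap)
        also have "\<dots> = (\<Sum>\<mu>\<in>F. \<Sum>\<nu>\<in>F. z \<mu> v * z \<nu> v * (if \<mu> = \<nu> then 1 else 0))"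
          using F orth by (intro sum.cong refl) (simp add: sum_distrib_left[symmetric] subset_eq)
        also have "\<dots> = p v" using F by (simp add: p_def if_distrib cong: if_cong)
        finally show ?thesis .
      qed
      have "0 \<le> (\<Sum>u\<in>V. ((if u = v then 1 else 0) - p u)\<^sup>2)" by (intro sum_nonneg) auto
      also have "\<dots> = (\<Sum>u\<in>V. (if u = v then 1 - 2 * p v else 0) + (p u)\<^sup>2)"
        by (intro sum.cong) (auto simp: power2_eq_square algebra_simps)
      also have "\<dots> = 1 - p v" using fin v pp by (simp add: sum.distrib)
      finally show ?thesis by (simp add: p_def power2_eq_square)
    qed
    \<comment> \<open>Double counting of all squared entries: each eigenvector contributes 1, each
      vertex at most 1.\<close>
    have "real (card F) = (\<Sum>\<mu>\<in>F. \<Sum>v\<in>V. (z \<mu> v)\<^sup>2)" using F z1 by (simp add: subset_eq)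
    also have "\<dots> = (\<Sum>v\<in>V. \<Sum>\<mu>\<in>F. (z \<mu> v)\<^sup>2)" by (rule sum.swap)
    also have "\<dots> \<le> (\<Sum>v\<in>V. 1)" by (intro sum_mono bessel)
    finally show ?thesis by simp
  qed
  then have "finite L \<and> card L \<le> card V" by (rule finite_if_finite_subsets_card_bdd)
  thus ?thesis by (simp add: L_def)
qed

text \<open>Perron-Frobenius comparison: at a vertex where the ratio of
  \<open>\<bar>y v\<bar>\<close> to \<open>z v\<close> is greatest, the eigenvalue equation of
  \<open>y\<close> is dominated by that of \<open>r * z\<close>.\<close>

lemma eigenvalue_le_positive_eigenvalue:
  fixes D :: "'a \<Rightarrow> 'a \<Rightarrow> real"
  assumes fin: "finite V" and nonneg: "\<And>u v. u \<in> V \<Longrightarrow> v \<in> V \<Longrightarrow> D u v \<ge> 0"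
    and z: "\<And>v. v \<in> V \<Longrightarrow> z v > 0" "\<And>u. u \<in> V \<Longrightarrow> (\<Sum>w\<in>V. D u w * z w) = \<rho> * z u"
    and y: "eigenpair_on V D \<mu> y"
  shows "\<mu> \<le> \<rho>"
proof -
  have ne: "V \<noteq> {}" using y by (auto simp: eigenpair_on_def)
  define r where "r = Max ((\<lambda>v. \<bar>y v\<bar> / z v) ` V)"
  have "r \<in> (\<lambda>v. \<bar>y v\<bar> / z v) ` V" unfolding r_def using fin ne by (intro Max_in) auto
  then obtain u where u: "u \<in> V" "r = \<bar>y u\<bar> / z u" by blast
  have le: "\<bar>y v\<bar> \<le> r * z v" if "v \<in> V" for v
  proof -
    have "\<bar>y v\<bar> / z v \<le> r" unfolding r_def using fin that by (intro Max_ge) auto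
    thus ?thesis using z(1)[OF that] by (simp add: field_simps)
  qed
  have yu: "\<bar>y u\<bar> = r * z u" using z(1)[OF u(1)] u(2) by simp
  have "\<bar>\<mu>\<bar> * \<bar>y u\<bar> = \<bar>\<Sum>w\<in>V. D u w * y w\<bar>"
    using y u(1) by (simp add: eigenpair_on_def abs_mult)
  also have "\<dots> \<le> (\<Sum>w\<in>V. \<bar>D u w * y w\<bar>)" by (rule sum_abs)
  also have "\<dots> \<le> (\<Sum>w\<in>V. r * (D u w * z w))"
  proof (rule sum_mono)
    fix w assume "w \<in> V"
    then have "D u w * \<bar>y w\<bar> \<le> D u w * (r * z w)" using le nonneg u by (intro mult_left_mono) auto
    then show "\<bar>D u w * y w\<bar> \<le> r * (D u w * z w)" using nonneg \<open>w \<in> V\<close> u by (simp add: abs_mult mult_ac)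
  qed
  also have "\<dots> = \<rho> * \<bar>y u\<bar>" using z(2)[OF u(1)] by (simp add: sum_distrib_left[symmetric] yu)
  finally have *: "\<bar>\<mu>\<bar> * \<bar>y u\<bar> \<le> \<rho> * \<bar>y u\<bar>" .
  have "y u \<noteq> 0"
  proof
    assume "y u = 0"
    hence "r = 0" using yu z(1)[OF u(1)] by simp
    hence "\<forall>v\<in>V. y v = 0" using le by auto
    thus False using y by (auto simp: eigenpair_on_def)
  qed
  with * show ?thesis by simp
qed

subsection \<open>Distances in graphs\<close>

lemma walk_rev:
  assumes "simple_graph V E" "walk V E xs"
  shows "walk V E (rev xs)"
  unfolding walk_def
proof (intro conjI allI impI)
  fix i assume i: "Suc i < length (rev xs)"
  define j where "j = length xs - Suc (Suc i)"
  have "rev xs ! i = xs ! Suc j" "rev xs ! Suc i = xs ! j"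
    using i by (simp_all add: rev_nth j_def Suc_diff_Suc)
  moreover have "E (xs ! j) (xs ! Suc j)" using i assms(2) by (simp add: walk_def j_def)
  ultimately show "E (rev xs ! i) (rev xs ! Suc i)"
    using assms(1) by (simp add: simple_graph_def)
qed (use assms in \<open>auto simp: walk_def\<close>)

lemma gdist_walk:
  assumes "connected_graph V E" "u \<in> V" "v \<in> V"
  obtains xs where "walk V E xs" "hd xs = u" "last xs = v" "length xs = Suc (gdist V E u v)"
proof -
  from assms obtain xs where xs: "walk V E xs" "hd xs = u" "last xs = v"
    by (auto simp: connected_graph_def)
  then have "length xs = Suc (length xs - 1)" by (simp add: walk_def)
  with xs have "\<exists>k xs. walk V E xs \<and> hd xs = u \<and> last xs = v \<and> length xs = Suc k" by blast
  from LeastI_ex[OF this] show ?thesis using that unfolding gdist_def by blast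
qed

lemma gdist_le:
  assumes "walk V E xs" "hd xs = u" "last xs = v" "length xs = Suc k"
  shows "gdist V E u v \<le> k"
  unfolding gdist_def using assms by (intro Least_le) blast

lemma gdist_commute_le:
  assumes "simple_graph V E" "connected_graph V E" "u \<in> V" "v \<in> V"
  shows "gdist V E v u \<le> gdist V E u v"
proof -
  from gdist_walk[OF assms(2-4)] obtain xs where xs: "walk V E xs" "hd xs = u" "last xs = v"
    "length xs = Suc (gdist V E u v)" .
  then show ?thesis using walk_rev[OF assms(1) xs(1)]
    by (intro gdist_le[of V E "rev xs"]) (auto simp: hd_rev last_rev walk_def)
qed

lemma gdist_commute:
  assumes "simple_graph V E" "connected_graph V E" "u \<in> V" "v \<in> V"
  shows "gdist V E u v = gdist V E v u"
  using gdist_commute_le assms by (metis le_antisym)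

lemma gdist_eq_0_iff:
  assumes "connected_graph V E" "u \<in> V" "v \<in> V"
  shows "gdist V E u v = 0 \<longleftrightarrow> u = v"
proof
  assume d: "gdist V E u v = 0"
  from gdist_walk[OF assms] obtain xs where "hd xs = u" "last xs = v" "length xs = Suc (gdist V E u v)" .
  with d show "u = v" by (auto simp: length_Suc_conv)
next
  assume "u = v"
  then have "gdist V E u v \<le> 0" using assms by (intro gdist_le[of V E "[u]"]) (auto simp: walk_def)
  then show "gdist V E u v = 0" by simp
qed

lemma gdist_eq_1_iff:
  assumes "simple_graph V E" "connected_graph V E" "u \<in> V" "v \<in> V"
  shows "gdist V E u v = 1 \<longleftrightarrow> E u v"
proof
  assume d: "gdist V E u v = 1"
  from gdist_walk[OF assms(2-4)] obtain xs where xs: "walk V E xs" "hd xs = u" "last xs = v"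
    "length xs = Suc (gdist V E u v)" .
  with d obtain y z where "xs = [y, z]" by (auto simp: length_Suc_conv)
  with xs show "E u v" by (auto simp: walk_def)
next
  assume e: "E u v"
  then have "gdist V E u v \<le> 1"
    using assms(3,4) by (intro gdist_le[of V E "[u, v]"]) (auto simp: walk_def)
  moreover have "u \<noteq> v" using e assms(1) by (auto simp: simple_graph_def)
  then have "gdist V E u v \<noteq> 0" using gdist_eq_0_iff assms by metis
  ultimately show "gdist V E u v = 1" by simp
qed

text \<open>Every edge has exactly one end in \<open>A\<close>, so membership in \<open>A\<close>
  alternates along a walk.\<close>

lemma bipartite_walk_parity:
  assumes "\<And>u v. E u v \<Longrightarrow> u \<in> A \<longleftrightarrow> v \<notin> A" "walk V E xs" "i < length xs"
  shows "xs ! i \<in> A \<longleftrightarrow> (hd xs \<in> A \<longleftrightarrow> even i)"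
  using assms(3)
proof (induction i)
  case 0
  then show ?case by (simp add: hd_conv_nth)
next
  case (Suc i)
  then have "E (xs ! i) (xs ! Suc i)" using assms(2) by (simp add: walk_def)
  then show ?case using Suc assms(1) by auto
qed

lemma gdist_parity:
  assumes "\<And>u v. E u v \<Longrightarrow> u \<in> A \<longleftrightarrow> v \<notin> A" "connected_graph V E" "u \<in> V" "v \<in> V"
  shows "even (gdist V E u v) \<longleftrightarrow> (u \<in> A \<longleftrightarrow> v \<in> A)"
proof -
  from gdist_walk[OF assms(2-4)] obtain xs where xs: "walk V E xs" "hd xs = u" "last xs = v"
    "length xs = Suc (gdist V E u v)" .
  then have "xs ! gdist V E u v = v" by (metis diff_Suc_1 last_conv_nth length_0_conv nat.distinct(1))
  then show ?thesis using bipartite_walk_parity[OF assms(1) xs(1), of "gdist V E u v"] xs by auto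
qed

lemma connected_graph_has_neighbour:
  assumes "connected_graph V E" "u \<in> V" "v \<in> V" "u \<noteq> v"
  shows "\<exists>w. E u w"
proof -
  from gdist_walk[OF assms(1-3)] obtain xs where xs: "walk V E xs" "hd xs = u"
    "length xs = Suc (gdist V E u v)" .
  moreover have "gdist V E u v \<noteq> 0" using gdist_eq_0_iff assms by metis
  ultimately have "E (xs ! 0) (xs ! Suc 0)" by (auto simp: walk_def)
  then show ?thesis using xs by (auto simp: hd_conv_nth walk_def)
qed

lemma dist_eigenvalue_iff_eigenpair:
  "dist_eigenvalue V E \<mu> \<longleftrightarrow> (\<exists>x. eigenpair_on V (\<lambda>u w. real (gdist V E u w)) \<mu> x)"
  by (simp add: dist_eigenvalue_def eigenpair_on_def)

lemma finite_dist_eigenvalues: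
  assumes "simple_graph V E" "connected_graph V E"
  shows "finite {\<mu>. dist_eigenvalue V E \<mu>}"
  unfolding dist_eigenvalue_iff_eigenpair
  using assms gdist_commute[OF assms] by (intro finite_eigenvalues_symmetric) (auto simp: simple_graph_def)

text \<open>The constant supplied by \<open>symmetric_max_eigenpair\<close> is itself an eigenvalue,
  hence at most the maximum that defines the spectral radius.\<close>

lemma rayleigh_le_dist_spectral_radius:
  assumes "simple_graph V E" "connected_graph V E"
  shows "(\<Sum>u\<in>V. \<Sum>w\<in>V. real (gdist V E u w) * y u * y w) \<le> dist_spectral_radius V E * (\<Sum>u\<in>V. (y u)\<^sup>2)"
proof -
  have "finite V" "V \<noteq> {}" using assms by (auto simp: simple_graph_def connected_graph_def)
  from symmetric_max_eigenpair[OF this, of "\<lambda>u w. real (gdist V E u w)"] gdist_commute[OF assms]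
  obtain \<mu> x where \<mu>: "eigenpair_on V (\<lambda>u w. real (gdist V E u w)) \<mu> x"
    "\<And>y. (\<Sum>u\<in>V. \<Sum>w\<in>V. real (gdist V E u w) * y u * y w) \<le> \<mu> * (\<Sum>u\<in>V. (y u)\<^sup>2)" by auto
  have "\<mu> \<le> dist_spectral_radius V E" unfolding dist_spectral_radius_def
  proof (rule Max_ge)
    show "\<mu> \<in> {\<mu>. dist_eigenvalue V E \<mu>}" using \<mu>(1) by (auto simp: dist_eigenvalue_iff_eigenpair)
  qed (rule finite_dist_eigenvalues[OF assms])
  then have "\<mu> * (\<Sum>u\<in>V. (y u)\<^sup>2) \<le> dist_spectral_radius V E * (\<Sum>u\<in>V. (y u)\<^sup>2)"
    by (intro mult_right_mono sum_nonneg) auto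
  with \<mu>(2)[of y] show ?thesis by linarith
qed

text \<open>The Rayleigh quotient of the graph is tested with a positive eigenvector of the smaller
  matrix \<open>D\<close>. The entrywise excess over \<open>D\<close>, weighted by
  \<open>x u * x w\<close>, sums to at most the gap between the spectral radius and
  \<open>\<rho>\<close> times the squared norm of \<open>x\<close>. Without a gap every nonnegative
  term vanishes, and positivity of \<open>x\<close> makes the entries agree.\<close>

lemma dist_spectral_radius_minorant:
  fixes D :: "'a \<Rightarrow> 'a \<Rightarrow> real"
  assumes G: "simple_graph V E" "connected_graph V E"
    and pos: "\<And>v. v \<in> V \<Longrightarrow> x v > 0"
    and eig: "\<And>u. u \<in> V \<Longrightarrow> (\<Sum>w\<in>V. D u w * x w) = \<rho> * x u"
    and le: "\<And>u v. u \<in> V \<Longrightarrow> v \<in> V \<Longrightarrow> D u v \<le> real (gdist V E u v)"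
  shows "\<rho> \<le> dist_spectral_radius V E"
    and "dist_spectral_radius V E \<le> \<rho> \<Longrightarrow> u \<in> V \<Longrightarrow> v \<in> V \<Longrightarrow> real (gdist V E u v) = D u v"
proof -
  define X where "X = (\<Sum>u\<in>V. (x u)\<^sup>2)"
  define d where "d u w = (real (gdist V E u w) - D u w) * x u * x w" for u w
  have fin: "finite V" "V \<noteq> {}" using G by (auto simp: simple_graph_def connected_graph_def)
  have X: "X > 0" unfolding X_def using fin pos by (intro sum_pos zero_less_power) auto
  have d: "d u w \<ge> 0" if "u \<in> V" "w \<in> V" for u w
    using that le pos unfolding d_def by (intro mult_nonneg_nonneg) (auto intro: less_imp_le)
  have "(\<Sum>u\<in>V. \<Sum>w\<in>V. D u w * x u * x w) = (\<Sum>u\<in>V. x u * (\<Sum>w\<in>V. D u w * x w))"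
    by (simp add: sum_distrib_left mult_ac)
  also have "\<dots> = (\<Sum>u\<in>V. \<rho> * (x u)\<^sup>2)"
    by (intro sum.cong refl) (simp only: eig, simp add: power2_eq_square)
  also have "\<dots> = \<rho> * X" by (simp add: X_def sum_distrib_left)
  finally have DX: "(\<Sum>u\<in>V. \<Sum>w\<in>V. D u w * x u * x w) = \<rho> * X" .
  have "(\<Sum>u\<in>V. \<Sum>w\<in>V. d u w) = (\<Sum>u\<in>V. \<Sum>w\<in>V. real (gdist V E u w) * x u * x w) - \<rho> * X"
    unfolding DX[symmetric] by (simp add: d_def left_diff_distrib sum_subtractf)
  also have "\<dots> \<le> dist_spectral_radius V E * X - \<rho> * X"
    using rayleigh_le_dist_spectral_radius[OF G, of x] by (simp add: X_def)
  finally have *: "(\<Sum>u\<in>V. \<Sum>w\<in>V. d u w) \<le> (dist_spectral_radius V E - \<rho>) * X"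
    by (simp add: left_diff_distrib)
  have "0 \<le> (\<Sum>u\<in>V. \<Sum>w\<in>V. d u w)" using d by (intro sum_nonneg) auto
  with * have "0 \<le> (dist_spectral_radius V E - \<rho>) * X" by linarith
  with X show "\<rho> \<le> dist_spectral_radius V E" by (simp add: zero_le_mult_iff)
  assume r: "dist_spectral_radius V E \<le> \<rho>" and uv: "u \<in> V" "v \<in> V"
  have "(dist_spectral_radius V E - \<rho>) * X \<le> 0" using r X by (simp add: mult_le_0_iff)
  with * \<open>0 \<le> (\<Sum>u\<in>V. \<Sum>w\<in>V. d u w)\<close> have "(\<Sum>u\<in>V. \<Sum>w\<in>V. d u w) = 0" by linarith
  then have "(\<Sum>w\<in>V. d u w) = 0"
    using sum_nonneg_eq_0_iff[OF fin(1), of "\<lambda>u. \<Sum>w\<in>V. d u w"] d uv by (simp add: sum_nonneg)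
  then have "d u v = 0" using sum_nonneg_eq_0_iff[OF fin(1), of "d u"] d uv by simp
  moreover have "x u \<noteq> 0" "x v \<noteq> 0" using pos[OF uv(1)] pos[OF uv(2)] by simp_all
  ultimately show "real (gdist V E u v) = D u v" by (simp add: d_def)
qed

lemma dist_spectral_radius_le_positive_eigenvalue:
  assumes G: "simple_graph V E" "connected_graph V E"
    and pos: "\<And>v. v \<in> V \<Longrightarrow> x v > 0"
    and eig: "\<And>u. u \<in> V \<Longrightarrow> (\<Sum>w\<in>V. real (gdist V E u w) * x w) = \<rho> * x u"
  shows "dist_spectral_radius V E \<le> \<rho>"
proof -
  have fin: "finite V" and "V \<noteq> {}" using G by (auto simp: simple_graph_def connected_graph_def)
  then obtain v where v: "v \<in> V" by blast
  have "x v \<noteq> 0" using pos[OF v] by simp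
  then have "eigenpair_on V (\<lambda>u w. real (gdist V E u w)) \<rho> x"
    using v eig unfolding eigenpair_on_def by blast
  \<comment> \<open>The maximum of an empty set is unspecified, so \<open>\<rho>\<close> is
    exhibited as an eigenvalue before the maximum is bounded.\<close>
  then have ne: "{\<mu>. dist_eigenvalue V E \<mu>} \<noteq> {}" by (auto simp: dist_eigenvalue_iff_eigenpair)
  have "\<mu> \<le> \<rho>" if "dist_eigenvalue V E \<mu>" for \<mu>
    using that eigenvalue_le_positive_eigenvalue[OF fin, of "\<lambda>u w. real (gdist V E u w)" x \<rho> \<mu>] pos eig
    by (auto simp: dist_eigenvalue_iff_eigenpair)
  then show ?thesis unfolding dist_spectral_radius_def
    using finite_dist_eigenvalues[OF G] ne by (intro Max.boundedI) auto
qed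

subsection \<open>Bipartite graphs with a deficient set\<close>

text \<open>The distance function of the complete bipartite graph with the edges between
  \<open>S\<close> and \<open>T\<close> deleted, as \<open>gdist_cut_graph\<close> confirms. The
  second part is represented by non-membership in \<open>A\<close>.\<close>

definition cut_dist :: "'a set \<Rightarrow> 'a set \<Rightarrow> 'a set \<Rightarrow> 'a \<Rightarrow> 'a \<Rightarrow> nat" where
  "cut_dist A S T u v = (if u = v then 0 else if u \<in> A \<longleftrightarrow> v \<in> A then 2
     else if u \<in> S \<and> v \<in> T \<or> u \<in> T \<and> v \<in> S then 3 else 1)"

text \<open>Summing the eigenvalue equations over \<open>A\<close> and over \<open>B\<close> gives a \<open>2 \<times> 2\<close> linear system for
  \<open>2 \<Sum>A + \<Sum>B\<close> and \<open>\<Sum>A + 2 \<Sum>B\<close>; its determinant is \<open>\<mu>\<^sup>2 - 4p\<close> times the polynomial below, where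
  \<open>\<mu>\<close> is the eigenvalue plus \<open>2\<close>.\<close>

definition cut_poly :: "real \<Rightarrow> real \<Rightarrow> real \<Rightarrow> real" where
  "cut_poly n p \<mu> = (\<mu> - 3 * n) * (\<mu> - n) * (\<mu>\<^sup>2 - 4 * p) - 4 * p * \<mu>\<^sup>2
     - 4 * p * (n + 1) * (2 * \<mu> - 3 * n) - 12 * p\<^sup>2"

text \<open>The quartic is monic, hence eventually positive, and the intermediate value theorem
  applies. This yields a first root above \<open>3 * n\<close> and later a larger root for a larger
  product \<open>p\<close>.\<close>

lemma cut_poly_root_above:
  assumes "cut_poly n p m < 0"
  shows "\<exists>\<mu>>m. cut_poly n p \<mu> = 0"
proof -
  \<comment> \<open>Coefficients of \<open>cut_poly\<close> in ascending powers of
    \<open>\<mu>\<close>.\<close>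
  define P where "P = [: - 12 * n\<^sup>2 * p + 12 * n * p * (n + 1) - 12 * p\<^sup>2,
    16 * n * p - 8 * p * (n + 1), 3 * n\<^sup>2 - 8 * p, - 4 * n, 1 :]"
  have P: "poly P x = cut_poly n p x" for x
    by (simp add: P_def cut_poly_def power2_eq_square algebra_simps)
  have "lead_coeff P > 0" by (simp add: P_def)
  from poly_pinfty_gt_lc[OF this] obtain c where c: "\<And>x. x \<ge> c \<Longrightarrow> poly P x \<ge> lead_coeff P" by blast
  have "poly P (max c (m + 1)) > 0" using c[of "max c (m + 1)"] \<open>lead_coeff P > 0\<close> by simp
  then have "\<exists>x>m. x < max c (m + 1) \<and> poly P x = 0" using assms by (intro poly_IVT_pos) (auto simp: P)
  then show ?thesis by (auto simp: P)
qed

lemma cut_poly_neg_at_3n: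
  assumes "n > 0" "p > 0"
  shows "cut_poly n p (3 * n) < 0"
proof -
  have "cut_poly n p (3 * n) = - (36 * p * n\<^sup>2 + 12 * p * (n + 1) * n + 12 * p\<^sup>2)"
    by (simp add: cut_poly_def power2_eq_square algebra_simps)
  moreover have "36 * p * n\<^sup>2 + 12 * p * (n + 1) * n + 12 * p\<^sup>2 > 0"
    using assms by (intro add_pos_pos mult_pos_pos) auto
  ultimately show ?thesis by linarith
qed

text \<open>The difference has the factor \<open>p' - p\<close>, and above \<open>3 * n\<close>
  every summand of the cofactor is positive. At a root for \<open>p\<close> the quartic for
  \<open>p'\<close> is therefore negative, which by \<open>cut_poly_root_above\<close> forces a
  larger root.\<close>

lemma cut_poly_strict_antimono:
  assumes "n > 0" "0 < p" "p < p'" "\<mu> > 3 * n"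
  shows "cut_poly n p' \<mu> < cut_poly n p \<mu>"
proof -
  have "cut_poly n p \<mu> - cut_poly n p' \<mu> = (p' - p) *
      (4 * ((\<mu> - 3 * n) * (\<mu> - n)) + 4 * \<mu>\<^sup>2 + 4 * ((n + 1) * (2 * \<mu> - 3 * n)) + 12 * (p + p'))"
    by (simp add: cut_poly_def power2_eq_square algebra_simps)
  also have "\<dots> > 0" using assms by (intro mult_pos_pos add_pos_pos) auto
  finally show ?thesis by simp
qed

text \<open>The values \<open>u\<close>, \<open>s\<close>, \<open>w\<close>, \<open>t\<close> are
  those of the eigenvector on \<open>S\<close>, \<open>A - S\<close>, \<open>T\<close>,
  \<open>B - T\<close>, where \<open>a = card S\<close> and \<open>b = card T\<close>. The last two
  equations express \<open>u\<close> and \<open>w\<close> through \<open>s\<close> and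
  \<open>t\<close>; the first two then become a homogeneous system of size two, singular exactly
  because \<open>cut_poly\<close> vanishes. The estimates serve to make its solution
  positive.\<close>

lemma cut_system_solution:
  fixes n a b \<mu> :: real
  assumes n: "n \<ge> 3" and a: "a \<ge> 2" and b: "b \<ge> 2" and ab: "a + b = n + 1" and \<mu>: "\<mu> > 3 * n"
    and root: "cut_poly n (a * b) \<mu> = 0"
  obtains u w s t :: real where "u > 0" "w > 0" "s > 0" "t > 0"
    "\<mu> * s = 2 * (a * u + (n - a) * s) + (b * w + (n - b) * t)"
    "\<mu> * t = (a * u + (n - a) * s) + 2 * (b * w + (n - b) * t)"
    "\<mu> * u = \<mu> * s + 2 * b * w" "\<mu> * w = \<mu> * t + 2 * a * u"
proof -
  define p where "p = a * b"
  define q where "q = \<mu>\<^sup>2 - 4 * p"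
  define M where "M = (\<mu> - 2 * n) * q - 2 * p * \<mu>"
  define N where "N = n * q + 4 * p * \<mu>"
  define \<alpha> where "\<alpha> = N + 4 * p * b"
  define \<beta> where "\<beta> = M - 8 * p * a"
  have p0: "p > 0" using a b by (simp add: p_def)
  \<comment> \<open>For a fixed sum the product is largest at equal factors. Together with
    \<open>n + 1 \<le> 4 / 3 * n\<close>, valid from \<open>n = 3\<close> on, this gives
    \<open>p \<le> 4 / 9 * n\<^sup>2\<close>, which is below half of \<open>n\<^sup>2\<close> as
    positivity of \<open>\<beta>\<close> requires.\<close>
  have "4 * p = (n + 1)\<^sup>2 - (a - b)\<^sup>2" unfolding ab[symmetric] p_def
    by (simp add: power2_eq_square algebra_simps)
  then have "4 * p \<le> (n + 1)\<^sup>2" by simp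
  also have "\<dots> \<le> (4 / 3 * n)\<^sup>2" using n by (intro power_mono) auto
  finally have p_le: "p \<le> 4 / 9 * n\<^sup>2" by (simp add: power2_eq_square)
  have \<mu>2: "\<mu>\<^sup>2 > (3 * n)\<^sup>2" using \<mu> n by (intro power_strict_mono) auto
  then have \<mu>2': "\<mu>\<^sup>2 > 9 * n\<^sup>2" by (simp add: power2_eq_square)
  have n2: "n\<^sup>2 > 0" using n by simp
  have q: "q > 0" using \<mu>2' p_le n2 unfolding q_def by linarith
  have "9 * n\<^sup>2 - 6 * p \<ge> 0" using p_le n2 by linarith
  \<comment> \<open>The right-hand product equals \<open>M + 4 * n * p\<close>, so this is a lower
    bound for \<open>M\<close>.\<close>
  then have "n * (9 * n\<^sup>2 - 6 * p) \<le> (\<mu> - 2 * n) * (\<mu>\<^sup>2 - 6 * p)"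
    using \<mu> \<mu>2' n by (intro mult_mono) auto
  then have "M \<ge> n * (9 * n\<^sup>2 - 10 * p)"
    unfolding M_def q_def by (simp add: algebra_simps)
  moreover have "n * (9 * n\<^sup>2 - 10 * p) > n * (8 * p)"
    using n p_le n2 by (intro mult_strict_left_mono) linarith+
  moreover have "a * (8 * p) \<le> n * (8 * p)" using ab b p0 by (intro mult_right_mono) auto
  ultimately have \<beta>: "\<beta> > 0" unfolding \<beta>_def by (simp add: algebra_simps)
  have \<alpha>: "\<alpha> > 0" unfolding \<alpha>_def N_def using n q p0 \<mu> b by (intro add_pos_pos mult_pos_pos) auto
  \<comment> \<open>\<open>\<alpha>\<close> and \<open>\<beta>\<close> are proportional to \<open>2 \<Sum>A + \<Sum>B\<close> and \<open>\<Sum>A + 2 \<Sum>B\<close>.\<close>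
  have key1: "(M - 8 * p * a) * \<alpha> = (N + 4 * p * b) * \<beta>" by (simp add: \<alpha>_def \<beta>_def)
  \<comment> \<open>\<open>\<alpha>\<close> and \<open>\<beta>\<close> are chosen to solve the first
    equation identically; the second then states that the determinant
    \<open>q * cut_poly n p \<mu>\<close> is zero.\<close>
  have key2: "(M - 8 * p * b) * \<beta> = (N + 4 * p * a) * \<alpha>"
  proof -
    have "(M - 8 * p * b) * \<beta> - (N + 4 * p * a) * \<alpha> =
        M\<^sup>2 - N\<^sup>2 - 4 * p * (a + b) * (2 * M + N) + 48 * p\<^sup>2 * (a * b)"
      unfolding \<alpha>_def \<beta>_def by (simp add: power2_eq_square algebra_simps)
    also have "\<dots> = M\<^sup>2 - N\<^sup>2 - 4 * p * (n + 1) * (2 * M + N) + 48 * p\<^sup>2 * p"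
      by (simp only: ab p_def[symmetric])
    also have "\<dots> = q * cut_poly n p \<mu>"
      unfolding M_def N_def cut_poly_def q_def by algebra
    finally show ?thesis using root by (simp add: p_def)
  qed
  show ?thesis
  proof
    \<comment> \<open>Elimination gives \<open>u = (\<alpha> * \<mu> + 2 * b * \<beta>) / q\<close>
      and \<open>s = \<alpha> / \<mu>\<close>, and likewise \<open>w\<close> and \<open>t\<close>;
      the witnesses are these values times \<open>\<mu> * q\<close>.\<close>
    show "\<mu> * (\<alpha> * \<mu> + 2 * b * \<beta>) > 0" "\<mu> * (\<beta> * \<mu> + 2 * a * \<alpha>) > 0" "q * \<alpha> > 0" "q * \<beta> > 0"
      using \<alpha> \<beta> q \<mu> n a b by (auto intro!: mult_pos_pos add_pos_pos)
    show "\<mu> * (\<mu> * (\<alpha> * \<mu> + 2 * b * \<beta>)) = \<mu> * (q * \<alpha>) + 2 * b * (\<mu> * (\<beta> * \<mu> + 2 * a * \<alpha>))"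
      "\<mu> * (\<mu> * (\<beta> * \<mu> + 2 * a * \<alpha>)) = \<mu> * (q * \<beta>) + 2 * a * (\<mu> * (\<alpha> * \<mu> + 2 * b * \<beta>))"
      by (simp_all add: q_def p_def power2_eq_square algebra_simps)
    have sA: "a * (\<mu> * (\<alpha> * \<mu> + 2 * b * \<beta>)) + (n - a) * (q * \<alpha>)
        = n * q * \<alpha> + 4 * p * a * \<alpha> + 2 * p * \<mu> * \<beta>"
      by (simp add: q_def p_def power2_eq_square algebra_simps)
    have sB: "b * (\<mu> * (\<beta> * \<mu> + 2 * a * \<alpha>)) + (n - b) * (q * \<beta>)
        = n * q * \<beta> + 4 * p * b * \<beta> + 2 * p * \<mu> * \<alpha>"
      by (simp add: q_def p_def power2_eq_square algebra_simps)
    show "\<mu> * (q * \<alpha>) = 2 * (a * (\<mu> * (\<alpha> * \<mu> + 2 * b * \<beta>)) + (n - a) * (q * \<alpha>)) +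
        (b * (\<mu> * (\<beta> * \<mu> + 2 * a * \<alpha>)) + (n - b) * (q * \<beta>))"
      unfolding sA sB using key1 unfolding M_def N_def by (simp add: algebra_simps)
    show "\<mu> * (q * \<beta>) = (a * (\<mu> * (\<alpha> * \<mu> + 2 * b * \<beta>)) + (n - a) * (q * \<alpha>)) +
        2 * (b * (\<mu> * (\<beta> * \<mu> + 2 * a * \<alpha>)) + (n - b) * (q * \<beta>))"
      unfolding sA sB using key2 unfolding M_def N_def by (simp add: algebra_simps)
  qed
qed

text \<open>The total \<open>n + 1\<close> is the least that contradicts Hall's condition when no
  edge joins \<open>S\<close> and \<open>T\<close>. With both sizes at least 2 it leaves
  \<open>A - S\<close> and \<open>B - T\<close> nonempty, so detours of length 2 and 3
  exist.\<close>

locale bipartite_cut =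
  fixes A B S T :: "'a set" and n :: nat
  assumes n: "n \<ge> 3" and fin: "finite A" "finite B" and disj: "A \<inter> B = {}"
    and card: "card A = n" "card B = n" and S: "S \<subseteq> A" and T: "T \<subseteq> B"
    and card_ST: "card S + card T = n + 1" and S2: "card S \<ge> 2" and T2: "card T \<ge> 2"
begin

text \<open>By this symmetry row sums need to be computed only for vertices of
  \<open>A\<close>.\<close>

lemma swap: "bipartite_cut B A T S n"
  using n fin disj card S T card_ST S2 T2 by unfold_locales auto

lemma cut_dist_swap:
  "u \<in> A \<union> B \<Longrightarrow> v \<in> A \<union> B \<Longrightarrow> cut_dist B T S u v = cut_dist A S T u v"
  using disj by (auto simp: cut_dist_def)

text \<open>Start from weight 2 on all of \<open>A\<close> and weight 1 on all of \<open>B\<close>.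
  The zero diagonal costs \<open>2 * x v\<close>, which turns \<open>\<mu>\<close> into the
  eigenvalue \<open>\<mu> - 2\<close>; for \<open>v\<close> in \<open>S\<close> each vertex of
  \<open>T\<close> adds 2, being at distance 3.\<close>

lemma cut_dist_row_sum:
  fixes a b c d :: real
  assumes v: "v \<in> A"
    and x: "\<And>y. x y = (if y \<in> S then a else if y \<in> T then b else if y \<in> A then c else d)"
  shows "(\<Sum>y\<in>A \<union> B. real (cut_dist A S T v y) * x y) =
    2 * (card S * a + (n - real (card S)) * c) + (card T * b + (n - real (card T)) * d)
    + (if v \<in> S then 2 * card T * b else 0) - 2 * x v"
proof -
  have finS: "finite S" and finT: "finite T" using S T fin finite_subset by auto
  have cardS: "real (card (A - S)) = n - real (card S)" and cardT: "real (card (B - T)) = n - real (card T)"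
    using S T finS finT fin card card_mono[of A S] card_mono[of B T]
    by (simp_all add: card_Diff_subset of_nat_diff)
  have "(\<Sum>y\<in>A. x y) = (\<Sum>y\<in>S. x y) + (\<Sum>y\<in>A - S. x y)"
    using S fin by (metis add.commute sum.subset_diff)
  also have "(\<Sum>y\<in>S. x y) = card S * a" by (simp add: x)
  also have "(\<Sum>y\<in>A - S. x y) = (\<Sum>y\<in>A - S. c)" using T disj by (intro sum.cong) (auto simp: x)
  also have "\<dots> = (n - real (card S)) * c"
    by (simp add: cardS)
  finally have sA: "(\<Sum>y\<in>A. x y) = card S * a + (n - real (card S)) * c" .
  have "(\<Sum>y\<in>B. x y) = (\<Sum>y\<in>T. x y) + (\<Sum>y\<in>B - T. x y)"
    using T fin by (metis add.commute sum.subset_diff)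
  also have "(\<Sum>y\<in>T. x y) = (\<Sum>y\<in>T. b)" using S T disj by (intro sum.cong) (auto simp: x)
  also have "(\<Sum>y\<in>B - T. x y) = (\<Sum>y\<in>B - T. d)" using S disj by (intro sum.cong) (auto simp: x)
  also have "\<dots> = (n - real (card T)) * d"
    by (simp add: cardT)
  finally have sB: "(\<Sum>y\<in>B. x y) = card T * b + (n - real (card T)) * d" by simp
  have "(\<Sum>y\<in>A. real (cut_dist A S T v y) * x y) = (\<Sum>y\<in>A. 2 * x y - (if y = v then 2 * x v else 0))"
    using v by (intro sum.cong) (auto simp: cut_dist_def)
  also have "\<dots> = 2 * (\<Sum>y\<in>A. x y) - 2 * x v"
    using v fin by (simp add: sum_subtractf sum_distrib_left)
  finally have 1: "(\<Sum>y\<in>A. real (cut_dist A S T v y) * x y) = 2 * (\<Sum>y\<in>A. x y) - 2 * x v" .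
  have "(\<Sum>y\<in>B. real (cut_dist A S T v y) * x y) =
      (\<Sum>y\<in>B. x y + (if y \<in> T then (if v \<in> S then 2 * b else 0) else 0))"
    using v disj S T by (intro sum.cong) (auto simp: cut_dist_def x)
  also have "\<dots> = (\<Sum>y\<in>B. x y) + (\<Sum>y\<in>B \<inter> T. if v \<in> S then 2 * b else 0)"
    using fin by (simp only: sum.distrib sum.inter_restrict)
  also have "B \<inter> T = T" using T by blast
  finally have 2: "(\<Sum>y\<in>B. real (cut_dist A S T v y) * x y) =
    (\<Sum>y\<in>B. x y) + (if v \<in> S then 2 * card T * b else 0)" by simp
  show ?thesis using fin disj by (simp add: sum.union_disjoint 1 2 sA sB)
qed

lemma cut_dist_positive_eigenvector:
  assumes \<mu>: "\<mu> > 3 * real n" and root: "cut_poly n (card S * card T) \<mu> = 0"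
  shows "\<exists>x. (\<forall>v\<in>A \<union> B. x v > 0) \<and>
    (\<forall>v\<in>A \<union> B. (\<Sum>y\<in>A \<union> B. real (cut_dist A S T v y) * x y) = (\<mu> - 2) * x v)"
proof -
  have ab: "real (card S) + real (card T) = real n + 1" using card_ST by linarith
  have c: "real n \<ge> 3" "real (card S) \<ge> 2" "real (card T) \<ge> 2" using n S2 T2 by simp_all
  have "cut_poly n (real (card S) * real (card T)) \<mu> = 0" using root by simp
  from cut_system_solution[OF c ab \<mu> this] obtain u w s t :: real
    where pos: "u > 0" "w > 0" "s > 0" "t > 0" and eqs:
    "\<mu> * s = 2 * (real (card S) * u + (real n - real (card S)) * s) + (real (card T) * w + (real n - real (card T)) * t)"
    "\<mu> * t = (real (card S) * u + (real n - real (card S)) * s) + 2 * (real (card T) * w + (real n - real (card T)) * t)"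
    "\<mu> * u = \<mu> * s + 2 * real (card T) * w" "\<mu> * w = \<mu> * t + 2 * real (card S) * u" .
  define x where "x y = (if y \<in> S then u else if y \<in> T then w else if y \<in> A then s else t)" for y
  interpret sw: bipartite_cut B A T S n by (rule swap)
  have xsw: "x y = (if y \<in> T then w else if y \<in> S then u else if y \<in> B then t else s)"
    if "y \<in> A \<union> B" for y using that S T disj by (auto simp: x_def)
  show ?thesis
  proof (intro exI[of _ x] conjI ballI)
    fix v assume "v \<in> A \<union> B"
    show "x v > 0" using pos by (simp add: x_def)
  next
    fix v assume v: "v \<in> A \<union> B"
    show "(\<Sum>y\<in>A \<union> B. real (cut_dist A S T v y) * x y) = (\<mu> - 2) * x v"
    proof (cases "v \<in> A")
      case True
      then have "v \<notin> T" using T disj by blast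
      with True show ?thesis
        unfolding cut_dist_row_sum[OF True x_def] using eqs by (auto simp: x_def algebra_simps)
    next
      case False
      then have vB: "v \<in> B" and vS: "v \<notin> S" using v S by auto
      \<comment> \<open>\<open>x'\<close> agrees with \<open>x\<close> on all vertices, but its case
        order is the one that the row sum lemma expects after exchanging the parts.\<close>
      define x' where "x' y = (if y \<in> T then w else if y \<in> S then u else if y \<in> B then t else s)" for y
      have "(\<Sum>y\<in>A \<union> B. real (cut_dist A S T v y) * x y) = (\<Sum>y\<in>B \<union> A. real (cut_dist B T S v y) * x' y)"
        using v by (intro sum.cong) (auto simp: xsw x'_def cut_dist_swap)
      also have "\<dots> = (\<mu> - 2) * x' v"
        unfolding sw.cut_dist_row_sum[OF vB x'_def] using eqs vB vS by (auto simp: x'_def algebra_simps)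
      also have "x' v = x v" using v by (simp add: xsw x'_def)
      finally show ?thesis .
    qed
  qed
qed

text \<open>Parity decides: distinct vertices of one part have positive even distance, vertices of
  different parts odd distance, and distance 1 is excluded between \<open>S\<close> and
  \<open>T\<close>.\<close>

lemma cut_dist_le_gdist:
  assumes "connected_graph (A \<union> B) E" "simple_graph (A \<union> B) E"
    and bip: "\<And>u v. E u v \<Longrightarrow> (u \<in> A \<and> v \<in> B) \<or> (u \<in> B \<and> v \<in> A)"
    and cut: "\<And>u v. u \<in> S \<Longrightarrow> v \<in> T \<Longrightarrow> \<not> E u v"
    and uv: "u \<in> A \<union> B" "v \<in> A \<union> B"
  shows "cut_dist A S T u v \<le> gdist (A \<union> B) E u v"
proof -
  let ?d = "gdist (A \<union> B) E u v"
  have "even ?d \<longleftrightarrow> (u \<in> A \<longleftrightarrow> v \<in> A)"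
    using bip disj by (intro gdist_parity[OF _ assms(1) uv]) blast
  moreover have "?d = 0 \<longleftrightarrow> u = v" by (rule gdist_eq_0_iff[OF assms(1) uv])
  moreover have "?d \<noteq> 1" if "u \<in> S \<and> v \<in> T \<or> u \<in> T \<and> v \<in> S"
    using that cut gdist_eq_1_iff[OF assms(2,1) uv] assms(2) unfolding simple_graph_def by blast
  moreover have "?d \<ge> 2" if "even ?d" "?d \<noteq> 0" using that by (auto elim!: evenE)
  moreover have "?d \<ge> 1" if "odd ?d" using that by (auto elim!: oddE)
  moreover have "?d \<ge> 3" if "odd ?d" "?d \<noteq> 1" using that by (auto elim!: oddE)
  ultimately show ?thesis unfolding cut_dist_def by auto
qed

text \<open>Adjacency is phrased through \<open>cut_dist\<close> so that a graph with these
  distances is seen at once to have these edges.\<close>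

definition cut_graph :: "'a \<Rightarrow> 'a \<Rightarrow> bool" where
  "cut_graph u v \<longleftrightarrow> u \<in> A \<union> B \<and> v \<in> A \<union> B \<and> cut_dist A S T u v = 1"

lemma cut_graph_iff:
  "cut_graph u v \<longleftrightarrow> (u \<in> A \<and> v \<in> B \<and> (u \<in> S \<longrightarrow> v \<notin> T)) \<or> (u \<in> B \<and> v \<in> A \<and> (v \<in> S \<longrightarrow> u \<notin> T))"
  using disj S T by (auto simp: cut_graph_def cut_dist_def)

lemma simple_cut_graph: "simple_graph (A \<union> B) cut_graph"
  using fin disj by (auto simp: simple_graph_def cut_graph_iff)

lemma cut_graph_walk:
  assumes uv: "u \<in> A \<union> B" "v \<in> A \<union> B"
  shows "\<exists>xs. walk (A \<union> B) cut_graph xs \<and> hd xs = u \<and> last xs = v \<and> length xs = Suc (cut_dist A S T u v)"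
proof -
  \<comment> \<open>\<open>c\<close> outside \<open>T\<close> is adjacent to all of \<open>A\<close>
    and \<open>d\<close> outside \<open>S\<close> to all of \<open>B\<close>; every detour below
    passes through one or both.\<close>
  have "card S < card A" "card T < card B" using card card_ST S2 T2 by auto
  then obtain c d where c: "c \<in> B" "c \<notin> T" and d: "d \<in> A" "d \<notin> S"
    using S T by (metis order_less_irrefl subset_antisym subsetI)
  have w2: "walk (A \<union> B) cut_graph [u, v]" if "cut_graph u v"
    using that uv by (auto simp: walk_def)
  have w3: "walk (A \<union> B) cut_graph [u, y, v]" if "cut_graph u y" "cut_graph y v" for y
    using that uv by (auto simp: walk_def nth_Cons cut_graph_def split: nat.splits)
  have w4: "walk (A \<union> B) cut_graph [u, y, z, v]" if "cut_graph u y" "cut_graph y z" "cut_graph z v" for y z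
    using that uv by (auto simp: walk_def nth_Cons cut_graph_def split: nat.splits)
  consider "u = v" | "u \<noteq> v" "u \<in> A" "v \<in> A" | "u \<noteq> v" "u \<in> B" "v \<in> B"
    | "u \<in> S" "v \<in> T" | "u \<in> T" "v \<in> S" | "cut_graph u v"
    using uv S T disj by (auto simp: cut_graph_iff)
  then show ?thesis
  proof cases
    case 1
    then show ?thesis using uv by (intro exI[of _ "[u]"]) (auto simp: walk_def cut_dist_def)
  next
    case 2
    then have "cut_graph u c" "cut_graph c v" using c disj by (auto simp: cut_graph_iff)
    with 2 show ?thesis by (intro exI[of _ "[u, c, v]"]) (auto simp: cut_dist_def w3)
  next
    case 3
    then have "cut_graph u d" "cut_graph d v" using d disj by (auto simp: cut_graph_iff)
    moreover have "u \<notin> A" "v \<notin> A" using 3 disj by auto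
    ultimately show ?thesis using 3 by (intro exI[of _ "[u, d, v]"]) (auto simp: cut_dist_def w3)
  next
    case 4
    then have "cut_graph u c" "cut_graph c d" "cut_graph d v" using c d S T by (auto simp: cut_graph_iff)
    moreover have "u \<in> A" "v \<notin> A" using 4 S T disj by auto
    ultimately show ?thesis using 4 by (intro exI[of _ "[u, c, d, v]"]) (auto simp: cut_dist_def w4)
  next
    case 5
    then have "cut_graph u d" "cut_graph d c" "cut_graph c v" using c d S T by (auto simp: cut_graph_iff)
    moreover have "u \<notin> A" "v \<in> A" using 5 S T disj by auto
    ultimately show ?thesis using 5 by (intro exI[of _ "[u, d, c, v]"]) (auto simp: cut_dist_def w4)
  next
    case 6
    then show ?thesis using w2 by (intro exI[of _ "[u, v]"]) (auto simp: cut_graph_def)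
  qed
qed

lemma connected_cut_graph: "connected_graph (A \<union> B) cut_graph"
proof -
  have "A \<noteq> {}" using card n by auto
  then show ?thesis unfolding connected_graph_def using cut_graph_walk by blast
qed

lemma gdist_cut_graph:
  assumes "u \<in> A \<union> B" "v \<in> A \<union> B"
  shows "gdist (A \<union> B) cut_graph u v = cut_dist A S T u v"
proof (rule antisym)
  show "gdist (A \<union> B) cut_graph u v \<le> cut_dist A S T u v"
    using cut_graph_walk[OF assms] gdist_le by metis
  show "cut_dist A S T u v \<le> gdist (A \<union> B) cut_graph u v"
    using disj S T by (intro cut_dist_le_gdist[OF connected_cut_graph simple_cut_graph _ _ assms])
      (auto simp: cut_graph_iff)
qed

lemma dist_spectral_radius_cut_graph_le:
  assumes "\<mu> > 3 * real n" "cut_poly n (card S * card T) \<mu> = 0"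
  shows "dist_spectral_radius (A \<union> B) cut_graph \<le> \<mu> - 2"
proof -
  from cut_dist_positive_eigenvector[OF assms] obtain x where
    "\<And>v. v \<in> A \<union> B \<Longrightarrow> x v > 0"
    "\<And>v. v \<in> A \<union> B \<Longrightarrow> (\<Sum>y\<in>A \<union> B. real (cut_dist A S T v y) * x y) = (\<mu> - 2) * x v" by blast
  then show ?thesis
    by (intro dist_spectral_radius_le_positive_eigenvalue[OF simple_cut_graph connected_cut_graph, of x])
      (auto simp: gdist_cut_graph)
qed

end

section \<open>Isomorphism of cut graphs\<close>

lemma ex_bij_betw_subset:
  assumes "finite A" "finite A'" "card A = card A'" "S \<subseteq> A" "S' \<subseteq> A'" "card S = card S'"
  shows "\<exists>f. bij_betw f A A' \<and> (\<forall>u\<in>A. f u \<in> S' \<longleftrightarrow> u \<in> S)"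
proof -
  have fS: "finite S" "finite S'" using assms finite_subset by auto
  then obtain g where g: "bij_betw g S S'" using assms finite_same_card_bij by blast
  have "card (A - S) = card (A' - S')" using assms fS by (simp add: card_Diff_subset)
  then obtain h where h: "bij_betw h (A - S) (A' - S')"
    using assms finite_same_card_bij by blast
  define f where "f u = (if u \<in> S then g u else h u)" for u
  have "bij_betw f S S'" using g by (subst bij_betw_cong[of _ _ g]) (auto simp: f_def)
  moreover have "bij_betw f (A - S) (A' - S')" using h by (subst bij_betw_cong[of _ _ h]) (auto simp: f_def)
  ultimately have "bij_betw f (S \<union> (A - S)) (S' \<union> (A' - S'))" by (rule bij_betw_combine) auto
  moreover have "S \<union> (A - S) = A" "S' \<union> (A' - S') = A'" using assms by auto
  moreover have "f u \<in> S' \<longleftrightarrow> u \<in> S" if "u \<in> A" for u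
    using that g h by (auto simp: f_def bij_betw_def)
  ultimately show ?thesis by metis
qed

text \<open>Equal \<open>card S\<close> forces equal \<open>card T\<close>, both totals being
  \<open>n + 1\<close>. Bijections of the parts that respect the marked subsets then glue to an
  isomorphism.\<close>

lemma cut_graphs_isomorphic:
  assumes "bipartite_cut A B S T n" "bipartite_cut A' B' S' T' n" "card S = card S'"
  shows "graph_iso (A \<union> B) (bipartite_cut.cut_graph A B S T) (A' \<union> B') (bipartite_cut.cut_graph A' B' S' T')"
proof -
  interpret G: bipartite_cut A B S T n by fact
  interpret H: bipartite_cut A' B' S' T' n by fact
  have "card T = card T'" using G.card_ST H.card_ST assms(3) by simp
  obtain f where f: "bij_betw f A A'" "\<And>u. u \<in> A \<Longrightarrow> f u \<in> S' \<longleftrightarrow> u \<in> S"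
    using ex_bij_betw_subset[of A A' S S'] G.fin H.fin G.card H.card G.S H.S assms(3) by metis
  obtain g where g: "bij_betw g B B'" "\<And>u. u \<in> B \<Longrightarrow> g u \<in> T' \<longleftrightarrow> u \<in> T"
    using ex_bij_betw_subset[of B B' T T'] G.fin H.fin G.card H.card G.T H.T \<open>card T = card T'\<close> by metis
  define h where "h u = (if u \<in> A then f u else g u)" for u
  have hf: "h u = f u" if "u \<in> A" for u using that by (simp add: h_def)
  have hg: "h u = g u" if "u \<in> B" for u using that G.disj by (auto simp: h_def)
  have "bij_betw h A A'" using f(1) by (subst bij_betw_cong[of _ _ f]) (auto simp: hf)
  moreover have "bij_betw h B B'" using g(1) by (subst bij_betw_cong[of _ _ g]) (auto simp: hg)
  ultimately have h: "bij_betw h (A \<union> B) (A' \<union> B')" using H.disj by (rule bij_betw_combine)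
  have fA: "h u \<in> A'" "h u \<notin> B'" "h u \<in> S' \<longleftrightarrow> u \<in> S" "u \<notin> B" if "u \<in> A" for u
    using that f G.disj H.disj by (auto simp: hf bij_betw_def)
  have gB: "h u \<in> B'" "h u \<notin> A'" "h u \<in> T' \<longleftrightarrow> u \<in> T" "u \<notin> A" if "u \<in> B" for u
    using that g G.disj H.disj by (auto simp: hg bij_betw_def)
  have "G.cut_graph u v \<longleftrightarrow> H.cut_graph (h u) (h v)" if uv: "u \<in> A \<union> B" "v \<in> A \<union> B" for u v
  proof -
    consider "u \<in> A" "v \<in> A" | "u \<in> A" "v \<in> B" | "u \<in> B" "v \<in> A" | "u \<in> B" "v \<in> B"
      using uv by blast
    then show ?thesis
      by cases (simp_all add: G.cut_graph_iff H.cut_graph_iff fA gB)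
  qed
  with h show ?thesis unfolding graph_iso_def by blast
qed

section \<open>From a missing perfect matching to a cut\<close>

lemma deficient_set_if_no_perfect_matching:
  assumes G: "simple_graph (A \<union> B) E" and disj: "A \<inter> B = {}" and card: "card A = card B"
    and bip: "\<And>u v. E u v \<Longrightarrow> (u \<in> A \<and> v \<in> B) \<or> (u \<in> B \<and> v \<in> A)"
    and no: "\<not> has_perfect_matching (A \<union> B) E"
  shows "\<exists>S\<subseteq>A. card {v. \<exists>u\<in>S. E u v} < card S"
proof (rule ccontr)
  assume "\<not> ?thesis"
  then have hall: "card S \<le> card (\<Union>u\<in>S. {v. E u v})" if "S \<subseteq> A" for S
    using that by (force simp: not_less UNION_eq)
  have fin: "finite A" "finite B" using G by (auto simp: simple_graph_def)
  have NB: "{v. E u v} \<subseteq> B" if "u \<in> A" for u using that bip disj by blast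
  have "finite {v. E u v}" if "u \<in> A" for u using NB[OF that] fin(2) by (rule finite_subset)
  from hall_marriage[OF fin(1) this hall]
  obtain f where f: "inj_on f A" "\<And>u. u \<in> A \<Longrightarrow> E u (f u)" by blast
  have "f ` A \<subseteq> B" using f(2) NB by blast
  \<comment> \<open>The two parts have equal size, so the injection from Hall's theorem is onto and
    its edges also cover \<open>B\<close>.\<close>
  then have fB: "f ` A = B"
    using fin card card_image[OF f(1)] by (intro card_subset_eq) auto
  define M where "M = (\<lambda>u. {u, f u}) ` A"
  have "perfect_matching (A \<union> B) E M" unfolding perfect_matching_def
  proof (intro conjI ballI)
    fix e assume "e \<in> M"
    then show "\<exists>u v. e = {u, v} \<and> E u v" using f(2) by (auto simp: M_def)
  next
    fix v assume "v \<in> A \<union> B"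
    then consider "v \<in> A" | u where "u \<in> A" "v = f u" using fB by blast
    then show "\<exists>!e. e \<in> M \<and> v \<in> e"
    proof cases
      case 1
      show ?thesis
      proof (rule ex1I[of _ "{v, f v}"])
        show "{v, f v} \<in> M \<and> v \<in> {v, f v}" using 1 by (simp add: M_def)
        fix e assume "e \<in> M \<and> v \<in> e"
        then show "e = {v, f v}" using 1 fB disj by (auto simp: M_def)
      qed
    next
      case 2
      show ?thesis
      proof (rule ex1I[of _ "{u, f u}"])
        show "{u, f u} \<in> M \<and> v \<in> {u, f u}" using 2 by (simp add: M_def)
        fix e assume "e \<in> M \<and> v \<in> e"
        then obtain w where w: "w \<in> A" "e = {w, f w}" "f u = w \<or> f u = f w" using 2 by (auto simp: M_def)
        then have "f u = f w" using 2 fB disj by blast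
        then have "u = w" using f(1) 2 w by (simp add: inj_on_def)
        then show "e = {u, f u}" using w by simp
      qed
    qed
  qed
  with no show False by (auto simp: has_perfect_matching_def)
qed

text \<open>A set \<open>S\<close> violating Hall's condition has at least
  \<open>n + 1 - card S\<close> non-neighbours in \<open>B\<close>, from which \<open>T\<close> is
  picked. If \<open>S\<close> were a singleton its vertex would be isolated, and if \<open>S\<close>
  were all of \<open>A\<close> the vertex in \<open>T\<close> would be; connectedness rules out
  both.\<close>

lemma bipartite_cut_if_no_perfect_matching:
  assumes n: "n \<ge> 3" and G: "simple_graph (A \<union> B) E" "connected_graph (A \<union> B) E"
    and disj: "A \<inter> B = {}" and card: "card A = n" "card B = n"
    and bip: "\<And>u v. E u v \<Longrightarrow> (u \<in> A \<and> v \<in> B) \<or> (u \<in> B \<and> v \<in> A)"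
    and no: "\<not> has_perfect_matching (A \<union> B) E"
  shows "\<exists>S T. bipartite_cut A B S T n \<and> (\<forall>u\<in>S. \<forall>v\<in>T. \<not> E u v)"
proof -
  have fin: "finite A" "finite B" using G by (auto simp: simple_graph_def)
  obtain S where S: "S \<subseteq> A" and def: "card {v. \<exists>u\<in>S. E u v} < card S"
    using deficient_set_if_no_perfect_matching[OF G(1) disj _ bip no] card by auto
  define N where "N = {v. \<exists>u\<in>S. E u v}"
  have NB: "N \<subseteq> B" using S bip disj by (auto simp: N_def)
  have finS: "finite S" using S fin finite_subset by blast
  have leS: "card S \<le> n" using S fin card card_mono by metis
  have "card (B - N) = n - card N" using NB fin card by (simp add: card_Diff_subset finite_subset)
  then have "n + 1 - card S \<le> card (B - N)" using def by (simp add: N_def)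
  then obtain T where T: "T \<subseteq> B - N" "card T = n + 1 - card S" "finite T"
    by (rule obtain_subset_with_card_n)
  have nbr: "\<exists>w. E u w" if u: "u \<in> A \<union> B" for u
  proof -
    have "A \<noteq> {}" "B \<noteq> {}" using card n by auto
    then obtain a b where "a \<in> A" "b \<in> B" by blast
    with u disj obtain v where "v \<in> A \<union> B" "u \<noteq> v" by blast
    with u show ?thesis using connected_graph_has_neighbour[OF G(2)] by blast
  qed
  have "card S \<noteq> 1"
  proof
    assume "card S = 1"
    then obtain s where s: "S = {s}" by (auto simp: card_1_singleton_iff)
    have "finite N" using NB fin finite_subset by blast
    then have "N = {}" using def \<open>card S = 1\<close> by (simp add: N_def)
    with nbr[of s] s S show False by (auto simp: N_def)
  qed
  then have S2: "card S \<ge> 2" using def by linarith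
  have "card S \<noteq> n"
  proof
    assume "card S = n"
    then have SA: "S = A" using S fin card by (intro card_subset_eq) auto
    have "card T = 1" using T(2) \<open>card S = n\<close> by simp
    then obtain t where t: "t \<in> T" by (auto simp: card_1_singleton_iff)
    with nbr[of t] T obtain w where "E t w" by blast
    then have "E w t" "w \<in> A" using G(1) t T bip disj by (auto simp: simple_graph_def)
    with t T SA show False by (auto simp: N_def)
  qed
  then have "card T \<ge> 2" using T(2) leS by linarith
  then have "bipartite_cut A B S T n"
    using n fin disj card S T S2 leS by unfold_locales auto
  moreover have "\<forall>u\<in>S. \<forall>v\<in>T. \<not> E u v" using T by (auto simp: N_def)
  ultimately show ?thesis by blast
qed

section \<open>The extremal graph and the conclusion\<close>

lemma bipartite_cut_B:
  assumes "n \<ge> 3"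
  shows "bipartite_cut {n..<2*n} {0..<n} {2*n-2, 2*n-1} {1..<n} n"
  using assms by unfold_locales auto

lemma B_verts_eq: "B_verts n = {n..<2*n} \<union> {0..<n}"
  by (auto simp: B_verts_def)

text \<open>The two pendent vertices form \<open>S\<close>, in one part with the
  \<open>n - 2\<close> vertices of the smaller side of the complete bipartite graph. Deleting their
  edges to \<open>{1..<n}\<close> leaves them only the neighbour 0.\<close>

lemma B_adj_eq:
  assumes "n \<ge> 3"
  shows "B_adj n = bipartite_cut.cut_graph {n..<2*n} {0..<n} {2*n-2, 2*n-1} {1..<n}"
proof (intro ext)
  fix u v
  interpret bipartite_cut "{n..<2*n}" "{0..<n}" "{2*n-2, 2*n-1}" "{1..<n}" n
    using assms by (rule bipartite_cut_B)
  show "B_adj n u v = cut_graph u v"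
    unfolding B_adj_def cut_graph_iff using assms by auto
qed

theorem theorem1p2:
  fixes V :: "'a set" and E :: "'a \<Rightarrow> 'a \<Rightarrow> bool" and n :: nat
  assumes "n \<ge> 3"
    and "simple_graph V E"
    and "connected_graph V E"
    and "balanced_bipartite V E n"
    and "dist_spectral_radius V E \<le> dist_spectral_radius (B_verts n) (B_adj n)"
  shows "\<not> graph_iso V E (B_verts n) (B_adj n) \<longrightarrow> has_perfect_matching V E"
proof (intro impI, rule ccontr)
  assume no_iso: "\<not> graph_iso V E (B_verts n) (B_adj n)" and no_pm: "\<not> has_perfect_matching V E"
  from assms(4) obtain A B where V: "V = A \<union> B" and AB: "A \<inter> B = {}" "card A = n" "card B = n"
    and bip: "\<And>u v. E u v \<Longrightarrow> (u \<in> A \<and> v \<in> B) \<or> (u \<in> B \<and> v \<in> A)"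
    unfolding balanced_bipartite_def by blast
  note G = assms(2,3)[unfolded V]
  from bipartite_cut_if_no_perfect_matching[OF assms(1) G AB bip] no_pm obtain S T
    where cut: "bipartite_cut A B S T n" and no_edge: "\<forall>u\<in>S. \<forall>v\<in>T. \<not> E u v" unfolding V by blast
  interpret C: bipartite_cut A B S T n by (rule cut)
  interpret K: bipartite_cut "{n..<2*n}" "{0..<n}" "{2*n-2, 2*n-1}" "{1..<n}" n
    using assms(1) by (rule bipartite_cut_B)
  have card_K: "card {2*n-2, 2*n-1} = 2" "card {1..<n} = n - 1" using assms(1) by auto
  \<comment> \<open>The product of the two cut sizes in the extremal graph; \<open>p'\<close> is the
    one in the given graph.\<close>
  define p where "p = 2 * (n - 1)"
  define p' where "p' = card S * card T"
  have p0: "p > 0" using assms(1) by (simp add: p_def)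
  obtain \<mu> where \<mu>: "\<mu> > 3 * real n" "cut_poly n p \<mu> = 0"
    using cut_poly_root_above[OF cut_poly_neg_at_3n[of "real n" "real p"]] assms(1) p0 by auto
  have "dist_spectral_radius (B_verts n) (B_adj n) \<le> \<mu> - 2"
    unfolding B_verts_eq B_adj_eq[OF assms(1)]
    using \<mu> by (intro K.dist_spectral_radius_cut_graph_le) (simp_all only: card_K p_def of_nat_mult)
  with assms(5) have rad: "dist_spectral_radius (A \<union> B) E \<le> \<mu> - 2" by (simp add: V)
  have le: "real (cut_dist A S T u v) \<le> real (gdist (A \<union> B) E u v)"
    if "u \<in> A \<union> B" "v \<in> A \<union> B" for u v
    using C.cut_dist_le_gdist[OF G(2,1) bip _ that] no_edge by auto
  \<comment> \<open>Since \<open>a + b + 4 = n + 1\<close>, the product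
    \<open>(a + 2) * (b + 2)\<close> exceeds \<open>2 * (n - 1)\<close> by exactly
    \<open>a * b\<close>; so \<open>p\<close> is least, and it is attained only if one of the sets
    has two elements.\<close>
  obtain a b where ab: "card S = a + 2" "card T = b + 2"
    using C.S2 C.T2 by (metis add.commute le_Suc_ex)
  have p'_eq: "p' = p + a * b"
    using C.card_ST by (simp add: p_def p'_def ab algebra_simps)
  show False
  proof (cases "a * b = 0")
    case False
    \<comment> \<open>A strictly larger product gives a root above \<open>\<mu>\<close>, so the
      spectral radius of the given graph would exceed \<open>\<mu> - 2\<close>.\<close>
    then have "cut_poly n p' \<mu> < 0"
      using cut_poly_strict_antimono[of "real n" "real p" "real p'" \<mu>] \<mu> p0 p'_eq assms(1) by simp
    then obtain \<mu>' where \<mu>': "\<mu>' > \<mu>" "cut_poly n p' \<mu>' = 0" using cut_poly_root_above by blast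
    then have "\<mu>' > 3 * real n" using \<mu> by simp
    from C.cut_dist_positive_eigenvector[OF this] \<mu>'(2) obtain x where
      "\<And>v. v \<in> A \<union> B \<Longrightarrow> x v > 0"
      "\<And>v. v \<in> A \<union> B \<Longrightarrow> (\<Sum>y\<in>A \<union> B. real (cut_dist A S T v y) * x y) = (\<mu>' - 2) * x v"
      unfolding p'_def by auto
    from dist_spectral_radius_minorant(1)[OF G this le] rad \<mu>'(1) show False by simp
  next
    case True
    then have p': "p' = p" using p'_eq by simp
    from C.cut_dist_positive_eigenvector[OF \<mu>(1)] \<mu>(2) obtain x where
      "\<And>v. v \<in> A \<union> B \<Longrightarrow> x v > 0"
      "\<And>v. v \<in> A \<union> B \<Longrightarrow> (\<Sum>y\<in>A \<union> B. real (cut_dist A S T v y) * x y) = (\<mu> - 2) * x v"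
      using p' unfolding p'_def by auto
    \<comment> \<open>Equality case: the spectral radius does not exceed that of the minorant, so
      all distances coincide and they determine the edges.\<close>
    from dist_spectral_radius_minorant(2)[OF G this le rad]
    have eq: "gdist (A \<union> B) E u v = cut_dist A S T u v" if "u \<in> A \<union> B" "v \<in> A \<union> B" for u v
      using that by simp
    have E_iff: "E u v \<longleftrightarrow> u \<in> A \<union> B \<and> v \<in> A \<union> B \<and> cut_dist A S T u v = 1" for u v
      using gdist_eq_1_iff[OF G, of u v] eq[of u v] bip[of u v] by auto
    have "E = C.cut_graph" by (intro ext) (simp add: E_iff C.cut_graph_def)
    \<comment> \<open>The set with two elements may lie in either part, so \<open>E\<close> is
      described in both orientations; the isomorphism uses the one that puts it first.\<close>
    moreover have "E = bipartite_cut.cut_graph B A T S"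
      by (intro ext) (use E_iff C.cut_dist_swap in \<open>auto simp: bipartite_cut.cut_graph_def[OF C.swap]\<close>)
    moreover have "card S = 2 \<or> card T = 2" using True ab by auto
    ultimately have "graph_iso V E (B_verts n) (B_adj n)"
      unfolding V B_verts_eq B_adj_eq[OF assms(1)]
      using cut_graphs_isomorphic[OF cut K.bipartite_cut_axioms]
        cut_graphs_isomorphic[OF C.swap K.bipartite_cut_axioms] card_K
      by (metis Un_commute)
    with no_iso show False ..
  qed
qed

end
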